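(* Let $E_n$ be the Euler numbers, defined by $\sum_{n\ge0}E_n\frac{x^n}{n!}=\operatorname{sech}x$, and let $F_n=nE_{n-1}$ (so that $\sum_{n\ge0}F_n\frac{x^n}{n!}=x\operatorname{sech}x$). For a nonnegative integer $n$ and an odd positive integer $j$, let $2^{\mu_{j,n}}$ be the highest power of $2$ dividing \[\sum_{i=0}^n(-1)^{n-i}\binom ni F_{2i+j}.\] Then $\mu_{j,0}=0$, $\mu_{j,1}=2$, and for $n>1$, $\mu_{j,n}=3n$ if $n$ is odd and $\mu_{j,n}=3n-1$ if $n$ is even. *)

theory Defs
  imports Complex_Main "HOL-Computational_Algebra.Formal_Power_Series"
begin

definition fps_cosh :: "rat fps" where
  "fps_cosh = fps_const (1 / 2) * (fps_exp 1 + fps_exp (- 1))"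

definition fps_sech :: "rat fps" where
  "fps_sech = inverse fps_cosh"

text \<open>
  The Euler numbers are the integer sequence with exponential generating function sech.
  Existence and uniqueness are shown below, in euler_number_egf and euler_number_unique.
\<close>
definition euler_number :: "nat \<Rightarrow> int" where
  "euler_number = (THE E. Abs_fps (\<lambda>n. of_int (E n) / fact n) = fps_sech)"

text \<open>The summand for n = 0 is 0, whatever the value of the truncated index n - 1.\<close>
definition F :: "nat \<Rightarrow> int" where
  "F n = int n * euler_number (n - 1)"

lemma fps_cosh_nth: "fps_nth fps_cosh n = (if even n then 1 / fact n else 0)"
  by (simp add: fps_cosh_def)

lemma fps_cosh_times_fps_sech: "fps_cosh * fps_sech = 1"
proof -
  have "fps_nth fps_cosh 0 \<noteq> 0"
    by (simp add: fps_cosh_nth)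
  then show ?thesis
    unfolding fps_sech_def by (metis inverse_mult_eq_1 mult.commute)
qed

lemma fact_times_fps_sech_nth_Ints: "fact n * fps_nth fps_sech n \<in> \<int>"
proof (induction n rule: less_induct)
  case (less n)
  have "(\<Sum>i=0..n. fps_nth fps_cosh i * fps_nth fps_sech (n - i)) = (if n = 0 then 1 else 0)"
    using arg_cong[OF fps_cosh_times_fps_sech, of "\<lambda>f. fps_nth f n"] by (simp add: fps_mult_nth)
  moreover have "{0..n} = insert 0 {1..n}"
    by auto
  ultimately have "fps_nth fps_sech n =
      (if n = 0 then 1 else 0) - (\<Sum>i=1..n. fps_nth fps_cosh i * fps_nth fps_sech (n - i))"
    by (simp add: fps_cosh_nth)
  then have "fact n * fps_nth fps_sech n = (if n = 0 then 1 else 0)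
      - (\<Sum>i=1..n. fact n * (fps_nth fps_cosh i * fps_nth fps_sech (n - i)))"
    by (simp add: right_diff_distrib sum_distrib_left)
  moreover have "fact n * (fps_nth fps_cosh i * fps_nth fps_sech (n - i)) \<in> \<int>"
    if "i \<in> {1..n}" for i
  proof (cases "even i")
    case True
    then have "fact n * (fps_nth fps_cosh i * fps_nth fps_sech (n - i)) =
        of_nat (n choose i) * (fact (n - i) * fps_nth fps_sech (n - i))"
      using that by (simp add: fps_cosh_nth binomial_fact field_simps)
    moreover have "fact (n - i) * fps_nth fps_sech (n - i) \<in> \<int>"
      using that by (intro less.IH) auto
    ultimately show ?thesis
      by (simp only: Ints_mult Ints_of_nat)
  qed (simp add: fps_cosh_nth)
  ultimately show ?case
    by (auto intro!: Ints_diff Ints_sum)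
qed

lemma euler_number_ex1: "\<exists>!E :: nat \<Rightarrow> int. Abs_fps (\<lambda>n. of_int (E n) / fact n) = fps_sech"
proof (rule ex_ex1I)
  have "\<forall>n. \<exists>k. fact n * fps_nth fps_sech n = of_int k"
    using fact_times_fps_sech_nth_Ints by (auto elim: Ints_cases)
  then obtain E :: "nat \<Rightarrow> int" where "\<forall>n. fact n * fps_nth fps_sech n = of_int (E n)"
    by (rule choice[THEN exE])
  then have "Abs_fps (\<lambda>n. of_int (E n) / fact n) = fps_sech"
    by (simp add: fps_eq_iff field_simps)
  then show "\<exists>E :: nat \<Rightarrow> int. Abs_fps (\<lambda>n. of_int (E n) / fact n) = fps_sech"
    by (rule exI[where x = E])
next
  fix E E' :: "nat \<Rightarrow> int"
  assume "Abs_fps (\<lambda>n. of_int (E n) / fact n) = fps_sech"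
    and "Abs_fps (\<lambda>n. of_int (E' n) / fact n) = fps_sech"
  then have "Abs_fps (\<lambda>n. of_int (E n) / fact n :: rat) = Abs_fps (\<lambda>n. of_int (E' n) / fact n)"
    by simp
  then show "E = E'"
    by (simp add: fps_eq_iff fun_eq_iff)
qed

lemma euler_number_egf: "Abs_fps (\<lambda>n. of_int (euler_number n) / fact n) = fps_sech"
  unfolding euler_number_def by (rule theI'[OF euler_number_ex1])

lemma euler_number_unique:
  "Abs_fps (\<lambda>n. of_int (E n) / fact n) = fps_sech \<Longrightarrow> euler_number = E"
  unfolding euler_number_def by (rule the1_equality[OF euler_number_ex1])

lemma F_egf: "Abs_fps (\<lambda>n. of_int (F n) / fact n) = fps_X * fps_sech"
proof (rule fps_ext)
  fix n
  show "fps_nth (Abs_fps (\<lambda>n. of_int (F n) / fact n)) n = fps_nth (fps_X * fps_sech) n"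
    by (cases n) (simp_all add: F_def flip: euler_number_egf)
qed

definition F_sum :: "nat \<Rightarrow> nat \<Rightarrow> int" where
  "F_sum j n = (\<Sum>i=0..n. (- 1) ^ (n - i) * int (n choose i) * F (2 * i + j))"

text \<open>
  This is the exponent of the highest power of 2 dividing the sum only if the sum is nonzero:
  multiplicity 2 0 is 0 by convention.
\<close>
definition \<mu> :: "nat \<Rightarrow> nat \<Rightarrow> nat" where
  "\<mu> j n = multiplicity 2 (F_sum j n)"

end

theory Submission
  imports Defs "HOL-Computational_Algebra.Polynomial"
begin

text \<open>
  For odd \<open>m\<close> one has \<open>F m = - (\<Sum>k\<le>m. (m choose k) * 4 ^ k * B k)\<close> with Bernoulli numbers
  \<open>B k\<close>. Hence, if \<open>L\<close> is the linear functional \<open>y ^ k \<mapsto> B k\<close> on polynomials (a Volkenborn integral)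
  and \<open>x = 1 + 4 y\<close>, then \<open>F m = - L (x ^ m)\<close>, and the alternating sum becomes
  \<open>- L (x ^ j * (x\<^sup>2 - 1) ^ n) = - (8 ^ n) * L (x ^ j * (y + 2 y\<^sup>2) ^ n)\<close>, because
  \<open>x\<^sup>2 - 1 = 8 (y + 2 y\<^sup>2)\<close>. The argument of \<open>L\<close> is \<open>y ^ n + 2 n y ^ (n + 1)\<close> modulo 4. Since every
  \<open>2 * B k\<close> is 2-integral, and a 2-adic unit for even \<open>k > 0\<close>, while \<open>B k = 0\<close> for odd \<open>k > 1\<close>, the value
  of \<open>L\<close> has 2-adic valuation \<open>- 1\<close> for \<open>n = 1\<close> and for even \<open>n > 0\<close>, and 0 otherwise.
\<close>

section \<open>Bernoulli numbers\<close>

text \<open>The shift turns e^x into (e^x - 1)/x, which has constant coefficient 1 and so is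
  invertible; the inverse is x/(e^x - 1), the convention with B_1 = -1/2.\<close>

definition bernoulli_fps :: "rat fps" where
  "bernoulli_fps = inverse (fps_shift 1 (fps_exp 1))"

definition bernoulli :: "nat \<Rightarrow> rat" where
  "bernoulli k = fact k * fps_nth bernoulli_fps k"

text \<open>For nonzero c this is c x/(e^(c x) - 1).\<close>

definition bernoulli_scaled :: "rat \<Rightarrow> rat fps" where
  "bernoulli_scaled c = bernoulli_fps oo (fps_const c * fps_X)"

lemma exp_minus_one_times_bernoulli: "(fps_exp 1 - 1) * bernoulli_fps = fps_X"
proof -
  have "fps_exp 1 - 1 = fps_X * fps_shift 1 (fps_exp 1 :: rat fps)"
    by (rule fps_ext) (simp add: fps_X_mult_nth)
  moreover have "fps_shift 1 (fps_exp 1 :: rat fps) * bernoulli_fps = 1"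
    unfolding bernoulli_fps_def by (subst mult.commute) (rule inverse_mult_eq_1, simp)
  ultimately show ?thesis
    by (simp add: mult.assoc)
qed

lemma exp_minus_one_times_bernoulli_scaled:
  "(fps_exp c - 1) * bernoulli_scaled c = fps_const c * fps_X"
proof -
  have "((fps_exp 1 - 1) * bernoulli_fps) oo (fps_const c * fps_X) = fps_X oo (fps_const c * fps_X)"
    by (simp only: exp_minus_one_times_bernoulli)
  then show ?thesis
    by (simp add: bernoulli_scaled_def fps_compose_mult_distrib fps_compose_sub_distrib)
qed

lemma exp_minus_one_nonzero: "c \<noteq> 0 \<Longrightarrow> fps_exp c - 1 \<noteq> (0 :: rat fps)"
  by (auto simp: fps_eq_iff intro!: exI[of _ 1])

lemma bernoulli_scaled_nth: "fps_nth (bernoulli_scaled c) k = c ^ k * bernoulli k / fact k"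
  by (simp add: bernoulli_scaled_def fps_compose_linear bernoulli_def)

lemma bernoulli_scaled_exp_nth:
  "fact m * fps_nth (bernoulli_scaled c * fps_exp d) m =
    (\<Sum>k\<le>m. of_nat (m choose k) * c ^ k * d ^ (m - k) * bernoulli k)"
  unfolding fps_mult_nth sum_distrib_left atLeast0AtMost
  by (rule sum.cong) (auto simp: bernoulli_scaled_nth binomial_fact)

lemma bernoulli_0: "bernoulli 0 = 1"
  by (simp add: bernoulli_def bernoulli_fps_def)

section \<open>Reflection and duplication formulas\<close>

text \<open>Because -x/(e^(-x) - 1) = x e^x/(e^x - 1) = x/(e^x - 1) + x. Comparing coefficients
  yields B_1 and the vanishing of the other odd-indexed numbers.\<close>

lemma bernoulli_scaled_minus_one: "bernoulli_scaled (- 1) = bernoulli_scaled 1 + fps_X"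
proof -
  let ?e = "fps_exp 1 :: rat fps" and ?e' = "fps_exp (- 1) :: rat fps"
  have e: "?e * ?e' = 1"
    by (simp flip: fps_exp_add_mult)
  have 1: "(?e - 1) * bernoulli_scaled 1 = fps_X"
    using exp_minus_one_times_bernoulli_scaled[of 1] by simp
  have 2: "(?e' - 1) * bernoulli_scaled (- 1) = - fps_X"
    using exp_minus_one_times_bernoulli_scaled[of "- 1"] by (simp flip: fps_const_neg)
  have "(?e - 1) * bernoulli_scaled (- 1) = - (?e * ((?e' - 1) * bernoulli_scaled (- 1)))"
    using e by algebra
  also have "\<dots> = (?e - 1) * (bernoulli_scaled 1 + fps_X)"
    unfolding 2 distrib_left 1 by (simp add: algebra_simps)
  finally have "(?e - 1) * bernoulli_scaled (- 1) = (?e - 1) * (bernoulli_scaled 1 + fps_X)" .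
  then show ?thesis
    using exp_minus_one_nonzero[of 1] by simp
qed

lemma bernoulli_reflect: "(- 1) ^ k * bernoulli k = bernoulli k + (if k = 1 then 1 else 0)"
proof -
  have "fps_nth (bernoulli_scaled (- 1)) k = fps_nth (bernoulli_scaled 1 + fps_X) k"
    by (simp only: bernoulli_scaled_minus_one)
  then show ?thesis
    by (auto simp: bernoulli_scaled_nth field_simps fps_X_def split: if_splits)
qed

lemma bernoulli_1: "bernoulli 1 = - 1 / 2"
  using bernoulli_reflect[of 1] by simp

lemma bernoulli_odd: "odd k \<Longrightarrow> k \<noteq> 1 \<Longrightarrow> bernoulli k = 0"
  using bernoulli_reflect[of k] by simp

text \<open>From e^(2x) - 1 = (e^x - 1)(e^x + 1), after cancelling e^x - 1.\<close>

lemma bernoulli_scaled_two: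
  "bernoulli_scaled 2 * fps_exp 1 + bernoulli_scaled 2 = 2 * bernoulli_scaled 1"
proof -
  let ?e = "fps_exp 1 :: rat fps"
  have e: "?e * ?e = fps_exp 2"
    by (simp flip: fps_exp_add_mult)
  have 1: "(?e - 1) * bernoulli_scaled 1 = fps_X"
    using exp_minus_one_times_bernoulli_scaled[of 1] by simp
  have 2: "(fps_exp 2 - 1) * bernoulli_scaled 2 = 2 * fps_X"
    using exp_minus_one_times_bernoulli_scaled[of 2] by (simp add: numeral_fps_const)
  have "(?e - 1) * (bernoulli_scaled 2 * ?e + bernoulli_scaled 2) = (fps_exp 2 - 1) * bernoulli_scaled 2"
    unfolding e[symmetric] by (simp add: algebra_simps)
  also have "\<dots> = (?e - 1) * (2 * bernoulli_scaled 1)"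
    unfolding 2 mult.left_commute[of _ 2] 1 ..
  finally have "(?e - 1) * (bernoulli_scaled 2 * ?e + bernoulli_scaled 2) =
      (?e - 1) * (2 * bernoulli_scaled 1)" .
  then show ?thesis
    using exp_minus_one_nonzero[of 1] by simp
qed

text \<open>The term k = m has been moved to the left, so B_m is determined by smaller indices. The
  weights 2^k make this recursion suited to 2-adic induction.\<close>

lemma bernoulli_duplication:
  "2 * (1 - 2 ^ m) * bernoulli m = (\<Sum>k<m. of_nat (m choose k) * 2 ^ k * bernoulli k)"
proof -
  have "fact m * fps_nth (bernoulli_scaled 2 * fps_exp 1 + bernoulli_scaled 2) m =
      fact m * fps_nth (2 * bernoulli_scaled 1) m"
    by (simp only: bernoulli_scaled_two)
  then have "(\<Sum>k\<le>m. of_nat (m choose k) * 2 ^ k * bernoulli k) + 2 ^ m * bernoulli m = 2 * bernoulli m"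
    using bernoulli_scaled_exp_nth[of m 2 1]
    by (simp add: distrib_left bernoulli_scaled_nth numeral_fps_const)
  then show ?thesis
    by (simp add: lessThan_Suc_atMost[symmetric] algebra_simps)
qed

section \<open>Euler numbers through Bernoulli numbers\<close>

text \<open>Let P(x) = 4x e^x/(e^(4x) - 1). Then P(x) - P(-x) = 4x (e^x - e^(3x))/(e^(4x) - 1) = -2x
  sech x, so the odd coefficients of P are those of -x sech x.\<close>

lemma F_eq_bernoulli_sum:
  assumes "odd m"
  shows "of_int (F m) = - (\<Sum>k\<le>m. of_nat (m choose k) * 4 ^ k * bernoulli k)"
proof -
  let ?e = "fps_exp 1 :: rat fps" and ?e' = "fps_exp (- 1) :: rat fps"
  let ?P = "bernoulli_scaled 4 * ?e" and ?N = "bernoulli_scaled (- 4) * ?e'"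
  have e: "?e * ?e' = 1"
    by (simp flip: fps_exp_add_mult)
  have e4: "?e ^ 4 = fps_exp 4" "?e' ^ 4 = fps_exp (- 4)"
    by (simp_all add: fps_exp_power_mult)
  have s: "(?e + ?e') * fps_sech = 2"
  proof -
    have "2 * fps_cosh = ?e + ?e'"
      by (rule fps_ext) (simp add: fps_cosh_def numeral_fps_const)
    then show ?thesis
      using fps_cosh_times_fps_sech by (metis mult.assoc mult.right_neutral)
  qed
  have 1: "(fps_exp 4 - 1) * bernoulli_scaled 4 = 4 * fps_X"
    using exp_minus_one_times_bernoulli_scaled[of 4] by (simp add: numeral_fps_const)
  have 2: "(fps_exp (- 4) - 1) * bernoulli_scaled (- 4) = - 4 * fps_X"
    using exp_minus_one_times_bernoulli_scaled[of "- 4"]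
    by (simp add: numeral_fps_const flip: fps_const_neg)
  have e44: "fps_exp 4 * fps_exp (- 4) = (1 :: rat fps)"
    by (simp flip: fps_exp_add_mult)
  have 3: "(fps_exp 4 - 1) * bernoulli_scaled (- 4) = 4 * fps_X * fps_exp 4"
    using 2 e44 by algebra
  \<comment> \<open>The identity is proved without quotients, after multiplication by the nonzero
    series e^(4x) - 1.\<close>
  have "(fps_exp 4 - 1) * (?P - ?N) = (fps_exp 4 - 1) * (- 2 * (fps_X * fps_sech))"
  proof -
    have "(fps_exp 4 - 1) * (?P - ?N) = 4 * fps_X * ?e - 4 * fps_X * (?e ^ 3 * (?e * ?e'))"
      using 1 3 unfolding e4[symmetric] by algebra
    also have "\<dots> = 4 * fps_X * ?e - 4 * fps_X * ?e ^ 3"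
      by (simp only: e mult_1_right)
    also have "\<dots> = - 2 * fps_X * (?e ^ 2 * (?e - ?e') * 2)"
      using e by algebra
    also have "\<dots> = (?e ^ 4 - 1) * (- 2 * (fps_X * fps_sech))"
      using e s by algebra
    finally show ?thesis
      by (simp only: e4)
  qed
  then have "?P - ?N = - 2 * (fps_X * fps_sech)"
    by (rule mult_left_cancel[OF exp_minus_one_nonzero, THEN iffD1, rotated]) simp
  then have "fact m * fps_nth (?P - ?N) m = fact m * fps_nth (- 2 * Abs_fps (\<lambda>n. of_int (F n) / fact n)) m"
    by (simp only: F_egf)
  also have "\<dots> = - 2 * of_int (F m)"
    by (simp add: numeral_fps_const flip: fps_const_neg)
  finally have "fact m * fps_nth ?P m - fact m * fps_nth ?N m = - 2 * of_int (F m)"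
    by (simp add: right_diff_distrib)
  \<comment> \<open>\<open>?N\<close> is \<open>?P\<close> with x replaced by -x, so coefficients of
    odd index change sign.\<close>
  moreover have "fact m * fps_nth ?N m = - (fact m * fps_nth ?P m)"
  proof -
    have "(- 4) ^ k * (- 1) ^ (m - k) = - (4 ^ k :: rat)" if "k \<le> m" for k
    proof -
      have "(- 4 :: rat) ^ k = (- 1) ^ k * 4 ^ k"
        by (simp flip: power_mult_distrib)
      moreover have "(- 1 :: rat) ^ k * (- 1) ^ (m - k) = - 1"
        using that assms by (simp flip: power_add)
      ultimately show ?thesis
        by (metis mult.assoc mult.commute mult_minus1)
    qed
    then show ?thesis
      unfolding bernoulli_scaled_exp_nth
      by (simp add: mult.assoc flip: sum_negf)
  qed
  ultimately show ?thesis
    using bernoulli_scaled_exp_nth[of m 4 1] by simp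
qed

section \<open>Rationals with odd denominator\<close>

text \<open>The localization of the integers at the prime 2.\<close>

definition two_integral :: "rat set" where
  "two_integral = {of_int a / of_int b | a b. odd b}"

lemma two_integral_of_int [simp]: "of_int a \<in> two_integral"
  unfolding two_integral_def by (rule CollectI, rule exI[of _ a], rule exI[of _ 1]) simp

lemma two_integral_add: "x \<in> two_integral \<Longrightarrow> y \<in> two_integral \<Longrightarrow> x + y \<in> two_integral"
  unfolding two_integral_def
proof clarify
  fix a b c d :: int
  assume "odd b" "odd d"
  then have "b \<noteq> 0" "d \<noteq> 0"
    by auto
  then have "of_int a / of_int b + of_int c / of_int d = (of_int (a * d + c * b) / of_int (b * d) :: rat)"
    by (simp add: field_simps)
  with \<open>odd b\<close> \<open>odd d\<close> show "\<exists>a' b'. of_int a / of_int b + of_int c / of_int d =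
      (of_int a' / of_int b' :: rat) \<and> odd b'"
    by (metis even_mult_iff)
qed

lemma two_integral_mult: "x \<in> two_integral \<Longrightarrow> y \<in> two_integral \<Longrightarrow> x * y \<in> two_integral"
  unfolding two_integral_def
proof clarify
  fix a b c d :: int
  assume "odd b" "odd d"
  then show "\<exists>a' b'. of_int a / of_int b * (of_int c / of_int d) =
      (of_int a' / of_int b' :: rat) \<and> odd b'"
    by (intro exI[of _ "a * c"] exI[of _ "b * d"]) simp
qed

lemma two_integral_sum: "(\<And>i. i \<in> I \<Longrightarrow> f i \<in> two_integral) \<Longrightarrow> sum f I \<in> two_integral"
  using two_integral_of_int[of 0]
  by (induction I rule: infinite_finite_induct) (auto intro: two_integral_add)

lemma two_integral_inverse_odd: "odd a \<Longrightarrow> 1 / of_int a \<in> two_integral"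
  unfolding two_integral_def by (rule CollectI, rule exI[of _ 1], rule exI[of _ a]) simp

lemma two_integral_numeral [simp]: "numeral w \<in> two_integral"
  using two_integral_of_int[of "numeral w"] by simp

lemma two_integral_of_nat [simp]: "of_nat k \<in> two_integral"
  using two_integral_of_int[of "int k"] by simp

lemma two_integral_power: "x \<in> two_integral \<Longrightarrow> x ^ k \<in> two_integral"
  using two_integral_of_int[of 1] by (induction k) (auto intro: two_integral_mult)

text \<open>For 2-integral z, 1 + 2z is a 2-adic unit. Writing z = a/b with b odd and clearing
  denominators leaves the odd integers b and b + 2a as cofactors.\<close>

lemma multiplicity_two_eq:
  fixes s :: int and z :: rat
  assumes z: "z \<in> two_integral"
    and s: "2 ^ d * of_int s = - (2 ^ e) * (1 + 2 * z)" and "d \<le> e"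
  shows "s \<noteq> 0 \<and> multiplicity 2 s = e - d"
proof -
  from z obtain a b where ab: "z = of_int a / of_int b" "odd b"
    unfolding two_integral_def by blast
  then have "b \<noteq> 0"
    by auto
  then have "of_int b * (2 ^ d * of_int s) = (- (2 ^ e) * (of_int b + 2 * of_int a) :: rat)"
    unfolding s ab by (simp add: field_simps)
  then have "of_int (b * (2 ^ d * s)) = (of_int (- (2 ^ e) * (b + 2 * a)) :: rat)"
    by simp
  then have "b * (2 ^ d * s) = - (2 ^ e) * (b + 2 * a)"
    by (simp only: of_int_eq_iff)
  also have "(2 :: int) ^ e = 2 ^ d * 2 ^ (e - d)"
    using \<open>d \<le> e\<close> by (simp flip: power_add)
  finally have "2 ^ d * (b * s) = 2 ^ d * (2 ^ (e - d) * (- (b + 2 * a)))"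
    by (simp add: algebra_simps)
  then have eq: "b * s = 2 ^ (e - d) * (- (b + 2 * a))"
    by (simp only: mult_cancel_left) simp
  have odd: "odd (- (b + 2 * a))"
    using \<open>odd b\<close> by simp
  then have "b * s \<noteq> 0"
    unfolding eq by (metis dvd_0_right mult_eq_0_iff power_not_zero zero_neq_numeral)
  then have "s \<noteq> 0"
    by simp
  have "multiplicity 2 (b * s) = multiplicity 2 b + multiplicity 2 s"
    using \<open>b \<noteq> 0\<close> \<open>s \<noteq> 0\<close> by (intro prime_elem_multiplicity_mult_distrib) auto
  moreover have "multiplicity 2 (2 ^ (e - d) * (- (b + 2 * a))) = e - d"
    using odd by (intro multiplicity_eqI) (auto simp: mult.commute)
  ultimately show ?thesis
    using \<open>s \<noteq> 0\<close> \<open>odd b\<close> eq by (simp add: not_dvd_imp_multiplicity_0)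
qed

section \<open>Bernoulli numbers at the prime 2\<close>

text \<open>The von Staudt-Clausen theorem at 2. In the duplication formula for even m > 0, the
  terms k = 0, 1 give the odd number 1 - m, later terms are even since 2^k B_k = 2 * 2^(k-2) * (2
  B_k), and the factor 1 - 2^m is odd.\<close>

lemma twice_bernoulli:
  "2 * bernoulli k \<in> two_integral \<and>
    (k > 0 \<longrightarrow> even k \<longrightarrow> (\<exists>z\<in>two_integral. 2 * bernoulli k = 1 + 2 * z))"
proof (induction k rule: less_induct)
  case (less m)
  show ?case
  proof (cases "m > 0 \<and> even m")
    case True
    then have m: "m \<ge> 2"
      by (auto elim: evenE)
    \<comment> \<open>Chosen so that the right-hand side of the duplication formula becomes 1 +
      2w.\<close>
    define w where "w = - of_int (int (m div 2)) +
      (\<Sum>k=2..<m. of_nat (m choose k) * 2 ^ (k - 2) * (2 * bernoulli k))"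
    have w: "w \<in> two_integral"
      unfolding w_def using less.IH
      by (intro two_integral_add two_integral_sum
          two_integral_mult[OF two_integral_mult[OF _ two_integral_power]])
        (simp_all flip: of_int_minus del: of_int_of_nat_eq)
    have "2 * (1 - 2 ^ m) * bernoulli m = (\<Sum>k<m. of_nat (m choose k) * 2 ^ k * bernoulli k)"
      by (rule bernoulli_duplication)
    also have "{..<m} = {0, 1} \<union> {2..<m}"
      using m by auto
    also have "(\<Sum>k\<in>{0, 1} \<union> {2..<m}. of_nat (m choose k) * 2 ^ k * bernoulli k) =
        1 - of_nat m + (\<Sum>k=2..<m. of_nat (m choose k) * 2 ^ k * bernoulli k)"
      by (subst sum.union_disjoint) (auto simp: bernoulli_0 bernoulli_1[simplified])
    also have "(\<Sum>k=2..<m. of_nat (m choose k) * 2 ^ k * bernoulli k) =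
        2 * (\<Sum>k=2..<m. of_nat (m choose k) * 2 ^ (k - 2) * (2 * bernoulli k))"
      unfolding sum_distrib_left
    proof (rule sum.cong)
      fix k assume "k \<in> {2..<m}"
      then have "(2 :: rat) ^ k = 2 ^ 2 * 2 ^ (k - 2)"
        by (metis atLeastLessThan_iff le_add_diff_inverse power_add)
      then show "of_nat (m choose k) * 2 ^ k * bernoulli k =
          2 * (of_nat (m choose k) * 2 ^ (k - 2) * (2 * bernoulli k))"
        by simp
    qed simp
    also have "(of_nat m :: rat) = 2 * of_int (int (m div 2))"
      using True by (auto elim!: evenE)
    finally have eq: "(1 - 2 ^ m) * (2 * bernoulli m) = 1 + 2 * w"
      by (simp add: w_def algebra_simps)
    \<comment> \<open>The solution of (1 - 2^m)(1 + 2z) = 1 + 2w.\<close>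
    define z where "z = (w + 2 ^ (m - 1)) * (1 / of_int (1 - 2 ^ m))"
    have "z \<in> two_integral"
      unfolding z_def using True w
      by (intro two_integral_mult two_integral_add two_integral_power two_integral_inverse_odd) auto
    moreover have "2 * bernoulli m = 1 + 2 * z"
    proof -
      have nz: "1 - (2 :: rat) ^ m \<noteq> 0"
        using one_less_power[of "2 :: rat" m] m by linarith
      then have "(1 - 2 ^ m) * z = w + 2 ^ (m - 1)"
        by (simp add: z_def)
      moreover have "(2 :: rat) ^ m = 2 * 2 ^ (m - 1)"
        using m by (simp flip: power_Suc)
      ultimately have "(1 - 2 ^ m) * (2 * bernoulli m) = (1 - 2 ^ m) * (1 + 2 * z)"
        unfolding eq by (simp add: distrib_left mult.left_commute[of _ 2])
      with nz show ?thesis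
        by (simp only: mult_cancel_left) simp
    qed
    ultimately show ?thesis
      using two_integral_of_int[of 1] by (auto intro: two_integral_add two_integral_mult two_integral_numeral)
  next
    case False
    then consider "m = 0" | "m = 1" | "odd m" "m \<noteq> 1"
      by auto
    then have "2 * bernoulli m \<in> two_integral"
      using two_integral_of_int[of "- 1"] two_integral_of_int[of 0]
      by cases (simp_all add: bernoulli_0 bernoulli_1[simplified] bernoulli_odd)
    with False show ?thesis
      by auto
  qed
qed

section \<open>The Bernoulli functional\<close>

definition bernoulli_functional :: "int poly \<Rightarrow> rat" where
  "bernoulli_functional p = (\<Sum>k\<le>degree p. of_int (coeff p k) * bernoulli k)"

text \<open>Any degree bound may replace the degree, so polynomials of different degrees can be
  compared over one index range.\<close>

lemma bernoulli_functional_eq: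
  "degree p \<le> N \<Longrightarrow> bernoulli_functional p = (\<Sum>k\<le>N. of_int (coeff p k) * bernoulli k)"
  unfolding bernoulli_functional_def
  by (rule sum.mono_neutral_left) (auto simp: coeff_eq_0)

lemma bernoulli_functional_add:
  "bernoulli_functional (p + q) = bernoulli_functional p + bernoulli_functional q"
proof -
  let ?N = "max (degree p) (degree q)"
  show ?thesis
    using bernoulli_functional_eq[of p ?N] bernoulli_functional_eq[of q ?N]
      bernoulli_functional_eq[of "p + q" ?N]
    by (simp add: degree_add_le_max distrib_right sum.distrib)
qed

lemma bernoulli_functional_smult:
  "bernoulli_functional (smult c p) = of_int c * bernoulli_functional p"
  using bernoulli_functional_eq[of "smult c p" "degree p"]
  by (simp add: degree_smult_le bernoulli_functional_def sum_distrib_left mult.assoc)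

lemma bernoulli_functional_0: "bernoulli_functional 0 = 0"
  by (simp add: bernoulli_functional_def)

lemma bernoulli_functional_sum:
  "bernoulli_functional (sum f I) = (\<Sum>i\<in>I. bernoulli_functional (f i))"
  by (induction I rule: infinite_finite_induct)
    (simp_all add: bernoulli_functional_add bernoulli_functional_0)

lemma bernoulli_functional_monom: "bernoulli_functional (monom c k) = of_int c * bernoulli k"
proof -
  have "bernoulli_functional (monom c k) = (\<Sum>i\<le>k. of_int (coeff (monom c k) i) * bernoulli i)"
    by (rule bernoulli_functional_eq) (rule degree_monom_le)
  also have "\<dots> = (\<Sum>i\<in>{k}. of_int (coeff (monom c k) i) * bernoulli i)"
    by (rule sum.mono_neutral_right) auto
  finally show ?thesis
    by simp
qed

text \<open>This controls the remainder of the expansion modulo 4: 4q is sent to twice a 2-integral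
  rational.\<close>

lemma twice_bernoulli_functional: "2 * bernoulli_functional p \<in> two_integral"
proof -
  have "2 * bernoulli_functional p = (\<Sum>k\<le>degree p. of_int (coeff p k) * (2 * bernoulli k))"
    by (simp add: bernoulli_functional_def sum_distrib_left mult_ac)
  also have "\<dots> \<in> two_integral"
    using twice_bernoulli by (intro two_integral_sum two_integral_mult[OF two_integral_of_int]) auto
  finally show ?thesis .
qed

lemma bernoulli_functional_linear_power:
  assumes "odd m"
  shows "bernoulli_functional ([:1, 4:] ^ m) = - of_int (F m)"
proof -
  have "degree ([:1, 4:] ^ m :: int poly) \<le> m"
    using degree_power_le[of "[:1, 4:] :: int poly" m] by simp
  then have "bernoulli_functional ([:1, 4:] ^ m) =
      (\<Sum>k\<le>m. of_int (coeff ([:1, 4:] ^ m) k) * bernoulli k)"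
    by (rule bernoulli_functional_eq)
  also have "\<dots> = (\<Sum>k\<le>m. of_nat (m choose k) * 4 ^ k * bernoulli k)"
    by (rule sum.cong) (auto simp: coeff_linear_poly_power)
  finally show ?thesis
    using F_eq_bernoulli_sum[OF assms] by simp
qed

text \<open>Expand (x^2 - 1)^n binomially for x = 1 + 4y and apply the functional termwise; each
  exponent 2i + j is odd because j is.\<close>

lemma F_sum_eq_bernoulli_functional:
  assumes "odd j"
  shows "of_int (F_sum j n) = - (8 ^ n) * bernoulli_functional ([:1, 4:] ^ j * [:0, 1, 2:] ^ n)"
proof -
  let ?x = "[:1, 4:] :: int poly"
  have "smult (8 ^ n) (?x ^ j * [:0, 1, 2:] ^ n) = ?x ^ j * (smult 8 [:0, 1, 2:]) ^ n"
    by (simp only: smult_power mult_smult_right)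
  also have "smult 8 [:0, 1, 2:] = ?x ^ 2 + (- 1)"
    by (simp add: power2_eq_square one_pCons)
  also have "?x ^ j * (?x ^ 2 + (- 1)) ^ n =
      (\<Sum>i\<le>n. ?x ^ j * (of_nat (n choose i) * (?x ^ 2) ^ i * (- 1) ^ (n - i)))"
    unfolding binomial_ring sum_distrib_left ..
  also have "\<dots> = (\<Sum>i\<le>n. smult ((- 1) ^ (n - i) * int (n choose i)) (?x ^ (2 * i + j)))"
  proof (rule sum.cong)
    fix i
    have "(- 1 :: int poly) ^ (n - i) = [:(- 1) ^ (n - i):]"
      by (simp add: one_pCons poly_const_pow)
    then show "?x ^ j * (of_nat (n choose i) * (?x ^ 2) ^ i * (- 1) ^ (n - i)) =
        smult ((- 1) ^ (n - i) * int (n choose i)) (?x ^ (2 * i + j))"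
      by (simp add: of_nat_poly power_add mult_ac flip: power_mult)
  qed simp
  finally have "of_int (8 ^ n) * bernoulli_functional (?x ^ j * [:0, 1, 2:] ^ n) =
      (\<Sum>i\<le>n. of_int ((- 1) ^ (n - i) * int (n choose i)) * bernoulli_functional (?x ^ (2 * i + j)))"
    by (metis (no_types, lifting) bernoulli_functional_smult bernoulli_functional_sum sum.cong)
  also have "\<dots> = - of_int (F_sum j n)"
    using assms
    by (simp add: bernoulli_functional_linear_power F_sum_def atLeast0AtMost sum_negf)
  finally show ?thesis
    by simp
qed

section \<open>Expansion modulo 4 and the valuation of the sum\<close>

lemma one_plus_mult_power:
  fixes c x :: "'a :: comm_ring_1"
  shows "\<exists>q. (1 + c * x) ^ n = 1 + of_nat n * c * x + c ^ 2 * q"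
proof (induction n)
  case (Suc n)
  then obtain q where "(1 + c * x) ^ n = 1 + of_nat n * c * x + c ^ 2 * q" ..
  then have "(1 + c * x) ^ Suc n =
      1 + of_nat (Suc n) * c * x + c ^ 2 * (q + of_nat n * x ^ 2 + c * x * q)"
    by (simp add: algebra_simps power2_eq_square)
  then show ?case ..
qed (auto intro: exI[of _ 0])

text \<open>Modulo 4, (1 + 4y)^j is 1, which removes j, and (1 + 2y)^n is 1 + 2ny.\<close>

lemma kernel_poly_mod_4:
  "\<exists>q. [:1, 4:] ^ j * [:0, 1, 2:] ^ n = monom 1 n + monom (2 * int n) (Suc n) + smult 4 q"
proof -
  \<comment> \<open>Naming the constants as polynomials reduces the claim to commutative ring
    algebra.\<close>
  define X two four :: "int poly" where "X = [:0, 1:]" and "two = [:2:]" and "four = [:4:]"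
  have eqs: "[:1, 4:] = 1 + four * X" "[:0, 1, 2:] = X * (1 + two * X)" "two ^ 2 = four"
    by (simp_all add: X_def two_def four_def one_pCons power2_eq_square)
  obtain q1 where q1: "(1 + four * X) ^ j = 1 + of_nat j * four * X + four ^ 2 * q1"
    using one_plus_mult_power by blast
  obtain q2 where q2: "(1 + two * X) ^ n = 1 + of_nat n * two * X + four * q2"
    using one_plus_mult_power[of two X n] unfolding eqs by blast
  define q where "q = X ^ n * (q2 + (of_nat j * X + four * q1) * (1 + two * X) ^ n)"
  have "[:1, 4:] ^ j * [:0, 1, 2:] ^ n = X ^ n + of_nat n * two * (X * X ^ n) + four * q"
    unfolding eqs power_mult_distrib q1 q_def q2 by (simp add: algebra_simps power2_eq_square)
  also have "\<dots> = monom 1 n + monom (2 * int n) (Suc n) + smult 4 q"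
    by (simp add: X_def two_def four_def monom_altdef of_nat_poly mult.commute)
  finally show ?thesis ..
qed

text \<open>After doubling, only the numbers 2 B_k occur, and the bracket multiplying -(8^n) is 1 +
  2z or 2(1 + 2z) with z 2-integral. The valuation is accordingly 3n - 1 or 3n.\<close>

lemma F_sum_two_adic:
  assumes "odd j"
  shows "F_sum j n \<noteq> 0 \<and>
    multiplicity 2 (F_sum j n) = (if n = 1 \<or> (n > 0 \<and> even n) then 3 * n - 1 else 3 * n)"
proof -
  obtain q where q: "[:1, 4:] ^ j * [:0, 1, 2:] ^ n =
      monom 1 n + monom (2 * int n) (Suc n) + smult 4 q"
    using kernel_poly_mod_4 by blast
  define u where "u = 2 * bernoulli_functional q"
  have u: "u \<in> two_integral"
    unfolding u_def by (rule twice_bernoulli_functional)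
  have "(2 :: rat) ^ (3 * n) = 8 ^ n"
    by (simp add: power_mult)
  then have s: "2 * of_int (F_sum j n) =
      - (2 ^ (3 * n)) * (2 * bernoulli n + of_nat n * 2 * (2 * bernoulli (Suc n)) + 4 * u)"
    unfolding F_sum_eq_bernoulli_functional[OF assms] q
    by (simp add: bernoulli_functional_add bernoulli_functional_smult bernoulli_functional_monom
        u_def algebra_simps)
  consider "n = 0" | "n = 1" | "n > 0" "even n" | "odd n" "n \<noteq> 1"
    by auto
  then show ?thesis
  proof cases
    case 1
    have "F_sum j n \<noteq> 0 \<and> multiplicity 2 (F_sum j n) = 3 * n - 0"
      by (rule multiplicity_two_eq[OF u]) (use s in \<open>simp_all add: 1 bernoulli_0\<close>)
    with 1 show ?thesis
      by simp
  next
    case 2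
    \<comment> \<open>Here 2 B_1 = -1 = 1 + 2(-1) is the odd term.\<close>
    define z where "z = - 1 + (2 * bernoulli 2 + 2 * u)"
    have "z \<in> two_integral"
      unfolding z_def using u twice_bernoulli[of 2] two_integral_of_int[of "- 1"]
      by (intro two_integral_add two_integral_mult[OF _ u]) auto
    then have "F_sum j n \<noteq> 0 \<and> multiplicity 2 (F_sum j n) = 3 * n - 1"
      by (rule multiplicity_two_eq)
        (use s in \<open>simp_all add: 2 z_def bernoulli_1[simplified] numeral_2_eq_2[symmetric]\<close>)
    with 2 show ?thesis
      by simp
  next
    case 3
    then obtain y where y: "y \<in> two_integral" "2 * bernoulli n = 1 + 2 * y"
      using twice_bernoulli by blast
    \<comment> \<open>The leading term 2 B_n is the unit; everything else in the bracket is
      even.\<close>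
    define z where "z = y + (of_nat n * (2 * bernoulli (Suc n)) + 2 * u)"
    have "z \<in> two_integral"
      unfolding z_def using u y twice_bernoulli
      by (intro two_integral_add two_integral_mult[OF two_integral_of_nat] two_integral_mult[OF _ u]) auto
    moreover have "2 * bernoulli n + of_nat n * 2 * (2 * bernoulli (Suc n)) + 4 * u = 1 + 2 * z"
      unfolding y z_def by (simp add: algebra_simps)
    ultimately have "F_sum j n \<noteq> 0 \<and> multiplicity 2 (F_sum j n) = 3 * n - 1"
      using s 3 by (intro multiplicity_two_eq[of z]) auto
    with 3 show ?thesis
      by simp
  next
    case 4
    then obtain y where y: "y \<in> two_integral" "2 * bernoulli (Suc n) = 1 + 2 * y"
      using twice_bernoulli[of "Suc n"] by auto
    obtain k where k: "n = 2 * k + 1"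
      using 4 by (auto elim: oddE)
    \<comment> \<open>Now B_n = 0, and the bracket is 2n(1 + 2y) + 4u, which is twice a unit because
      n = 2k + 1 is odd.\<close>
    define z where "z = of_nat k + (of_nat n * y + u)"
    have "z \<in> two_integral"
      unfolding z_def using u y
      by (intro two_integral_add two_integral_mult) auto
    moreover have "2 * bernoulli n + of_nat n * 2 * (2 * bernoulli (Suc n)) + 4 * u = 2 * (1 + 2 * z)"
      using 4 unfolding y z_def by (simp add: bernoulli_odd k algebra_simps)
    ultimately have "F_sum j n \<noteq> 0 \<and> multiplicity 2 (F_sum j n) = 3 * n - 0"
      using s by (intro multiplicity_two_eq[of z]) (auto simp: algebra_simps)
    with 4 show ?thesis
      by auto
  qed
qed

theorem theorem9p2:
  fixes j n :: nat
  assumes "odd j"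
  shows "F_sum j n \<noteq> 0 \<and> \<mu> j 0 = 0 \<and> \<mu> j 1 = 2 \<and>
    (n > 1 \<longrightarrow> (odd n \<longrightarrow> \<mu> j n = 3 * n) \<and> (even n \<longrightarrow> \<mu> j n = 3 * n - 1))"
  using F_sum_two_adic[OF assms, of 0] F_sum_two_adic[OF assms, of 1] F_sum_two_adic[OF assms, of n]
  by (auto simp: \<mu>_def)

end
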